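(* Let $M$ be a proper inascreen lightlike hypersurface of an indefinite almost contact metric manifold $(\bar M,\bar\phi,\zeta,\eta,\bar g)$, let $\phi$ and $\omega$ be the tensor fields on $M$ defined by $\bar\phi X=\phi X+\omega(X)\zeta$ for $X$ tangent to $M$, and let $\tilde g=g+\omega\otimes\omega$. Then $(\tilde g,\phi)$ is an almost Hermitian structure on $M$.
   Context: An indefinite almost contact metric manifold is an odd-dimensional semi-Riemannian manifold $(\bar M,\bar g)$ ($\bar g$ indefinite) with a $(1,1)$ tensor field $\bar\phi$, a vector field $\zeta$ (structure vector field) and a 1-form $\eta$ such that $\eta(\zeta)=1$, $\bar\phi^2=-I+\eta\otimes\zeta$ and $\bar g(\bar\phi X,\bar\phi Y)=\bar g(X,Y)-\eta(X)\eta(Y)$ for all $X,Y$ tangent to $\bar M$. (Consequently $\bar\phi\zeta=0$, $\eta\circ\bar\phi=0$, $\eta(X)=\bar g(X,\zeta)$ and $\bar\phi$ is skew-symmetric with respect to $\bar g$.) A hypersurface $M$ of $\bar M$ with $g=\bar g|_M$ is lightlike if $TM^\perp$ is a rank 1 vector subbundle of $TM$. A screen distribution $S(TM)$ is a (non-degenerate) complement of $TM^\perp$ in $TM$, so $TM=S(TM)\perp TM^\perp$. For a non-zero local section $\xi$ of $TM^\perp$ there is a unique transversal section $N$ with $\bar g(\xi,N)=1$ and $\bar g(N,N)=\bar g(N,Z)=0$ for all $Z\in S(TM)$; it spans the lightlike transversal bundle $\mathrm{tr}(TM)$, and $T\bar M|_M=S(TM)\perp\{TM^\perp\oplus\mathrm{tr}(TM)\}$.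 Write $\zeta=W+a\xi+bN$ along $M$ with $W$ a section of $S(TM)$; then $a=\eta(N)$ and $b=\eta(\xi)$. Standing conventions: the screen distribution is chosen so that $\bar\phi\xi$ is tangent to $S(TM)$ (then $\bar\phi N$ is also tangent to $S(TM)$), and $D'$ is the non-degenerate distribution with $S(TM)=\{\bar\phi TM^\perp+\bar\phi\,\mathrm{tr}(TM)\}\perp D'$ (orthogonal direct sum). Accordingly $W=W'+f_1\bar\phi N+f_2\bar\phi\xi$ with $W'$ a section of $D'$ (the $D'$-component of $W$) and $f_1,f_2$ smooth functions. $M$ is called inascreen if $W'\neq 0$ (nowhere zero), in which case $\zeta=W'+a\xi+bN$; it is proper inascreen if moreover $b\neq0$ (nowhere zero). For a proper inascreen $M$, $\zeta$ is nowhere tangent to $M$, so for $X$ tangent to $M$ one has a unique decomposition $\bar\phi X=\phi X+\omega(X)\zeta$ with $\phi X$ tangent to $M$; $\phi$ is a $(1,1)$ tensor field and $\omega$ a 1-form on $M$. For a symmetric $(0,2)$ tensor $h$ on $M$ (here possibly degenerate) and a $(1,1)$ tensor $\phi$, the pair $(h,\phi)$ is called an almost Hermitian structure if $\phi^2=-I$ and $h(\phi X,\phi Y)=h(X,Y)$ for all $X,Y$ tangent to $M$. (In particular $\tilde g$ is not required to be non-degenerate; it is in fact degenerate.) *)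

theory Defs
  imports "HOL-Analysis.Analysis"
begin

section \<open>Smooth maps between open subsets of Euclidean spaces\<close>

text \<open>On an open set, a map is of class \<open>C\<^sup>k\<^sup>+\<^sup>1\<close> iff it is differentiable and all its
  directional derivatives are of class \<open>C\<^sup>k\<close>.\<close>

primrec Ck_on :: "nat \<Rightarrow> 'a::euclidean_space set \<Rightarrow> ('a \<Rightarrow> 'b::euclidean_space) \<Rightarrow> bool" where
  "Ck_on 0 S f \<longleftrightarrow> continuous_on S f"
| "Ck_on (Suc k) S f \<longleftrightarrow> f differentiable_on S \<and>
     (\<forall>v. Ck_on k S (\<lambda>x. frechet_derivative f (at x) v))"

definition smooth_on :: "'a::euclidean_space set \<Rightarrow> ('a \<Rightarrow> 'b::euclidean_space) \<Rightarrow> bool" where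
  "smooth_on S f \<longleftrightarrow> open S \<and> (\<forall>k. Ck_on k S f)"


section \<open>Smooth manifolds and their tangent spaces\<close>

text \<open>A chart is a pair of its domain and its coordinate map.  A manifold is a whole type
  together with an atlas.\<close>

type_synonym ('m, 'e) chart = "'m set \<times> ('m \<Rightarrow> 'e)"

definition is_chart :: "('m::topological_space, 'e::euclidean_space) chart \<Rightarrow> bool" where
  "is_chart c \<longleftrightarrow> open (fst c) \<and> open (snd c ` fst c) \<and>
     (\<exists>y. homeomorphism (fst c) (snd c ` fst c) (snd c) y)"

definition chart_inv :: "('m, 'e) chart \<Rightarrow> 'e \<Rightarrow> 'm" where
  "chart_inv c = inv_into (fst c) (snd c)"

definition transition :: "('m, 'e) chart \<Rightarrow> ('m, 'e) chart \<Rightarrow> 'e \<Rightarrow> 'e" where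
  "transition c d = snd d \<circ> chart_inv c"

locale smooth_manifold =
  fixes A :: "('m::{t2_space,second_countable_topology}, 'e::euclidean_space) chart set"
  assumes charts: "c \<in> A \<Longrightarrow> is_chart c"
    and charts_cover: "(\<Union>c\<in>A. fst c) = UNIV"
    and transition_smooth:
      "\<lbrakk>c \<in> A; d \<in> A\<rbrakk> \<Longrightarrow> smooth_on (snd c ` (fst c \<inter> fst d)) (transition c d)"

text \<open>The tangent space at \<open>p\<close> is the model space \<open>'e\<close>: a tangent vector is given by its components
  with respect to one fixed chart \<open>chart_at A p\<close> around \<open>p\<close>.  As that chart depends on \<open>p\<close> in an
  uncontrolled way, smoothness of fields is always expressed through the components
  \<open>coords_of A c p v\<close> in a chart \<open>c\<close> that does not vary with \<open>p\<close>; \<open>vector_of A c p w\<close> is the tangent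
  vector at \<open>p\<close> with components \<open>w\<close> in \<open>c\<close>.\<close>

definition chart_at :: "('m, 'e) chart set \<Rightarrow> 'm \<Rightarrow> ('m, 'e) chart" where
  "chart_at A p = (SOME c. c \<in> A \<and> p \<in> fst c)"

definition coords_of ::
    "('m, 'e::euclidean_space) chart set \<Rightarrow> ('m, 'e) chart \<Rightarrow> 'm \<Rightarrow> 'e \<Rightarrow> 'e" where
  "coords_of A c p v =
     frechet_derivative (transition (chart_at A p) c) (at (snd (chart_at A p) p)) v"

definition vector_of ::
    "('m, 'e::euclidean_space) chart set \<Rightarrow> ('m, 'e) chart \<Rightarrow> 'm \<Rightarrow> 'e \<Rightarrow> 'e" where
  "vector_of A c p w = frechet_derivative (transition c (chart_at A p)) (at (snd c p)) w"

definition smooth_map ::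
    "('m::topological_space, 'e::euclidean_space) chart set \<Rightarrow>
     ('n::topological_space, 'f::euclidean_space) chart set \<Rightarrow> ('m \<Rightarrow> 'n) \<Rightarrow> bool" where
  "smooth_map A B F \<longleftrightarrow> continuous_on UNIV F \<and>
     (\<forall>c\<in>A. \<forall>d\<in>B. smooth_on (snd c ` (fst c \<inter> F -` fst d)) (snd d \<circ> F \<circ> chart_inv c))"

definition differential ::
    "('m, 'e::euclidean_space) chart set \<Rightarrow> ('n, 'f::euclidean_space) chart set \<Rightarrow>
     ('m \<Rightarrow> 'n) \<Rightarrow> 'm \<Rightarrow> 'e \<Rightarrow> 'f" where
  "differential A B F p =
     frechet_derivative (snd (chart_at B (F p)) \<circ> F \<circ> chart_inv (chart_at A p))
       (at (snd (chart_at A p) p))"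


section \<open>Tensor fields and distributions\<close>

definition vector_field_on ::
    "('m, 'e::euclidean_space) chart set \<Rightarrow> 'm set \<Rightarrow> ('m \<Rightarrow> 'e) \<Rightarrow> bool" where
  "vector_field_on A U X \<longleftrightarrow>
     (\<forall>c\<in>A. smooth_on (snd c ` (fst c \<inter> U))
       (\<lambda>u. coords_of A c (chart_inv c u) (X (chart_inv c u))))"

definition one_form ::
    "('m, 'e::euclidean_space) chart set \<Rightarrow> ('m \<Rightarrow> 'e \<Rightarrow> real) \<Rightarrow> bool" where
  "one_form A \<alpha> \<longleftrightarrow> (\<forall>p. linear (\<alpha> p)) \<and>
     (\<forall>c\<in>A. \<forall>w. smooth_on (snd c ` fst c)
       (\<lambda>u. \<alpha> (chart_inv c u) (vector_of A c (chart_inv c u) w)))"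

definition tensor_11 ::
    "('m, 'e::euclidean_space) chart set \<Rightarrow> ('m \<Rightarrow> 'e \<Rightarrow> 'e) \<Rightarrow> bool" where
  "tensor_11 A \<phi> \<longleftrightarrow> (\<forall>p. linear (\<phi> p)) \<and>
     (\<forall>c\<in>A. \<forall>w. smooth_on (snd c ` fst c)
       (\<lambda>u. coords_of A c (chart_inv c u)
              (\<phi> (chart_inv c u) (vector_of A c (chart_inv c u) w))))"

definition symmetric_tensor_02 ::
    "('m, 'e::euclidean_space) chart set \<Rightarrow> ('m \<Rightarrow> 'e \<Rightarrow> 'e \<Rightarrow> real) \<Rightarrow> bool" where
  "symmetric_tensor_02 A h \<longleftrightarrow> (\<forall>p. bilinear (h p)) \<and> (\<forall>p v w. h p v w = h p w v) \<and>
     (\<forall>c\<in>A. \<forall>v w. smooth_on (snd c ` fst c)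
       (\<lambda>u. h (chart_inv c u) (vector_of A c (chart_inv c u) v)
              (vector_of A c (chart_inv c u) w)))"

text \<open>A distribution of rank \<open>k\<close> is a rank \<open>k\<close> vector subbundle of the tangent bundle.\<close>

definition distribution ::
    "('m::topological_space, 'e::euclidean_space) chart set \<Rightarrow> nat \<Rightarrow> ('m \<Rightarrow> 'e set) \<Rightarrow> bool" where
  "distribution A k E \<longleftrightarrow> (\<forall>p. subspace (E p) \<and> dim (E p) = k) \<and>
     (\<forall>p. \<exists>U X. open U \<and> p \<in> U \<and> (\<forall>i<k. vector_field_on A U (X i)) \<and>
       (\<forall>q\<in>U. E q = span ((\<lambda>i. X i q) ` {..<k})))"


section \<open>Scalar products\<close>

definition nondegenerate_on :: "('e \<Rightarrow> 'e \<Rightarrow> real) \<Rightarrow> 'e::real_vector set \<Rightarrow> bool" where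
  "nondegenerate_on h V \<longleftrightarrow> (\<forall>v\<in>V. (\<forall>w\<in>V. h v w = 0) \<longrightarrow> v = 0)"

definition metric_index :: "('e::euclidean_space \<Rightarrow> 'e \<Rightarrow> real) \<Rightarrow> nat" where
  "metric_index h = Max {dim V |V :: 'e set. subspace V \<and> (\<forall>v\<in>V - {0}. h v v < 0)}"

text \<open>\<open>E = F \<perp> G\<close>\<close>

definition orth_direct_sum ::
    "('e \<Rightarrow> 'e \<Rightarrow> real) \<Rightarrow> 'e::real_vector set \<Rightarrow> 'e set \<Rightarrow> 'e set \<Rightarrow> bool" where
  "orth_direct_sum h E F G \<longleftrightarrow> E = {x + y |x y. x \<in> F \<and> y \<in> G} \<and> F \<inter> G = {0} \<and>
     (\<forall>x\<in>F. \<forall>y\<in>G. h x y = 0)"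


section \<open>Indefinite almost contact metric manifolds\<close>

locale indefinite_almost_contact_metric_manifold = smooth_manifold A
  for A :: "('m::{t2_space,second_countable_topology}, 'e::euclidean_space) chart set" +
  fixes phib :: "'m \<Rightarrow> 'e \<Rightarrow> 'e"
    and \<zeta> :: "'m \<Rightarrow> 'e"
    and \<eta> :: "'m \<Rightarrow> 'e \<Rightarrow> real"
    and gb :: "'m \<Rightarrow> 'e \<Rightarrow> 'e \<Rightarrow> real"
  assumes odd_dimension: "odd DIM('e)"
    and metric_tensor: "symmetric_tensor_02 A gb"
    and metric_nondegenerate: "nondegenerate_on (gb p) UNIV"
    and metric_indefinite:
      "\<exists>q. 0 < q \<and> q < DIM('e) \<and> (\<forall>p. metric_index (gb p) = q)"
    and phib_tensor: "tensor_11 A phib"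
    and zeta_field: "vector_field_on A UNIV \<zeta>"
    and eta_form: "one_form A \<eta>"
    and eta_zeta: "\<eta> p (\<zeta> p) = 1"
    and phib_squared: "phib p (phib p v) = - v + \<eta> p v *\<^sub>R \<zeta> p"
    and phib_metric: "gb p (phib p v) (phib p w) = gb p v w - \<eta> p v * \<eta> p w"


section \<open>Lightlike hypersurfaces\<close>

text \<open>A hypersurface is an immersion \<open>\<iota>\<close> of codimension 1, and \<open>T\<^sub>pM\<close> is identified with its image
  under \<open>d \<iota> p\<close>.  In particular \<open>rad p\<close> is \<open>TM\<^sup>\<perp>\<close> as a subset of \<open>T\<^sub>pM\<close>, whereas
  \<open>normal_space p\<close> is \<open>TM\<^sup>\<perp>\<close> as a subset of the ambient tangent space at \<open>\<iota> p\<close>.\<close>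

locale hypersurface =
  indefinite_almost_contact_metric_manifold A phib \<zeta> \<eta> gb + M: smooth_manifold B
  for A :: "('m::{t2_space,second_countable_topology}, 'e::euclidean_space) chart set"
    and phib :: "'m \<Rightarrow> 'e \<Rightarrow> 'e"
    and \<zeta> :: "'m \<Rightarrow> 'e"
    and \<eta> :: "'m \<Rightarrow> 'e \<Rightarrow> real"
    and gb :: "'m \<Rightarrow> 'e \<Rightarrow> 'e \<Rightarrow> real"
    and B :: "('n::{t2_space,second_countable_topology}, 'd::euclidean_space) chart set" +
  fixes \<iota> :: "'n \<Rightarrow> 'm"
  assumes codimension_1: "DIM('e) = DIM('d) + 1"
    and immersion_smooth: "smooth_map B A \<iota>"
    and immersion_inj: "inj (differential B A \<iota> p)"
begin

abbreviation d\<iota> :: "'n \<Rightarrow> 'd \<Rightarrow> 'e" where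
  "d\<iota> \<equiv> differential B A \<iota>"

definition induced_metric :: "'n \<Rightarrow> 'd \<Rightarrow> 'd \<Rightarrow> real" where
  "induced_metric p X Y = gb (\<iota> p) (d\<iota> p X) (d\<iota> p Y)"

definition normal_space :: "'n \<Rightarrow> 'e set" where
  "normal_space p = {v. \<forall>Y. gb (\<iota> p) v (d\<iota> p Y) = 0}"

definition rad :: "'n \<Rightarrow> 'd set" where
  "rad p = {X. d\<iota> p X \<in> normal_space p}"

definition lightlike :: bool where
  "lightlike \<longleftrightarrow> (\<forall>p. normal_space p \<subseteq> range (d\<iota> p)) \<and> distribution B 1 rad"

definition screen_distribution :: "('n \<Rightarrow> 'd set) \<Rightarrow> bool" where
  "screen_distribution S \<longleftrightarrow> (\<exists>k. distribution B k S) \<and>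
     (\<forall>p. nondegenerate_on (induced_metric p) (S p) \<and>
          orth_direct_sum (induced_metric p) UNIV (S p) (rad p))"

text \<open>\<open>N\<close> is the transversal vector at \<open>p\<close> associated with a non-zero \<open>\<xi> \<in> rad p\<close>.\<close>

definition is_transversal :: "('n \<Rightarrow> 'd set) \<Rightarrow> 'n \<Rightarrow> 'd \<Rightarrow> 'e \<Rightarrow> bool" where
  "is_transversal S p \<xi> N \<longleftrightarrow> gb (\<iota> p) (d\<iota> p \<xi>) N = 1 \<and> gb (\<iota> p) N N = 0 \<and>
     (\<forall>Z\<in>S p. gb (\<iota> p) N (d\<iota> p Z) = 0)"

definition tr :: "('n \<Rightarrow> 'd set) \<Rightarrow> 'n \<Rightarrow> 'e set" where
  "tr S p = span {N. \<exists>\<xi>\<in>rad p - {0}. is_transversal S p \<xi> N}"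

text \<open>The standing convention on the screen distribution, and the splitting
  \<open>S(TM) = {phib TM\<^sup>\<perp> + phib tr(TM)} \<perp> D'\<close>.\<close>

definition adapted_screen :: "('n \<Rightarrow> 'd set) \<Rightarrow> ('n \<Rightarrow> 'd set) \<Rightarrow> bool" where
  "adapted_screen S D' \<longleftrightarrow> screen_distribution S \<and>
     (\<forall>p. phib (\<iota> p) ` normal_space p \<subseteq> d\<iota> p ` S p) \<and>
     (\<exists>k. distribution B k D') \<and>
     (\<forall>p. nondegenerate_on (induced_metric p) (D' p) \<and>
          orth_direct_sum (gb (\<iota> p)) (d\<iota> p ` S p)
            {phib (\<iota> p) x + phib (\<iota> p) y |x y. x \<in> normal_space p \<and> y \<in> tr S p}
            (d\<iota> p ` D' p))"

text \<open>\<open>\<zeta> = W + a \<xi> + b N\<close> and \<open>W = W' + f\<^sub>1 phib N + f\<^sub>2 phib \<xi>\<close> at the point \<open>p\<close>.\<close>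

definition zeta_decomposition ::
    "('n \<Rightarrow> 'd set) \<Rightarrow> ('n \<Rightarrow> 'd set) \<Rightarrow> 'n \<Rightarrow> 'd \<Rightarrow> 'e \<Rightarrow> 'd \<Rightarrow> real \<Rightarrow> real \<Rightarrow> 'd \<Rightarrow> bool" where
  "zeta_decomposition S D' p \<xi> N W a b W' \<longleftrightarrow>
     is_transversal S p \<xi> N \<and> W \<in> S p \<and> W' \<in> D' p \<and>
     \<zeta> (\<iota> p) = d\<iota> p W + a *\<^sub>R d\<iota> p \<xi> + b *\<^sub>R N \<and>
     (\<exists>f\<^sub>1 f\<^sub>2. d\<iota> p W = d\<iota> p W' + f\<^sub>1 *\<^sub>R phib (\<iota> p) N + f\<^sub>2 *\<^sub>R phib (\<iota> p) (d\<iota> p \<xi>))"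

text \<open>For given \<open>\<xi>\<close>, the data \<open>N\<close>, \<open>W\<close>, \<open>a\<close>, \<open>b\<close>, \<open>W'\<close> exist and are unique; whether \<open>W'\<close>
  and \<open>b\<close> vanish at \<open>p\<close> does not depend on the choice of \<open>\<xi>\<close>.\<close>

definition inascreen :: "('n \<Rightarrow> 'd set) \<Rightarrow> ('n \<Rightarrow> 'd set) \<Rightarrow> bool" where
  "inascreen S D' \<longleftrightarrow> (\<forall>p. \<forall>\<xi>\<in>rad p - {0}. \<exists>N W a b W'.
     zeta_decomposition S D' p \<xi> N W a b W' \<and> W' \<noteq> 0)"

definition proper_inascreen :: "('n \<Rightarrow> 'd set) \<Rightarrow> ('n \<Rightarrow> 'd set) \<Rightarrow> bool" where
  "proper_inascreen S D' \<longleftrightarrow> inascreen S D' \<and> (\<forall>p. \<forall>\<xi>\<in>rad p - {0}. \<forall>N W a b W'.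
     zeta_decomposition S D' p \<xi> N W a b W' \<longrightarrow> b \<noteq> 0)"

end

locale proper_inascreen_lightlike_hypersurface =
  hypersurface A phib \<zeta> \<eta> gb B \<iota>
  for A :: "('m::{t2_space,second_countable_topology}, 'e::euclidean_space) chart set"
    and phib :: "'m \<Rightarrow> 'e \<Rightarrow> 'e"
    and \<zeta> :: "'m \<Rightarrow> 'e"
    and \<eta> :: "'m \<Rightarrow> 'e \<Rightarrow> real"
    and gb :: "'m \<Rightarrow> 'e \<Rightarrow> 'e \<Rightarrow> real"
    and B :: "('n::{t2_space,second_countable_topology}, 'd::euclidean_space) chart set"
    and \<iota> :: "'n \<Rightarrow> 'm" +
  fixes S :: "'n \<Rightarrow> 'd set"
    and D' :: "'n \<Rightarrow> 'd set"
  assumes lightlike: "lightlike"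
    and adapted_screen: "adapted_screen S D'"
    and proper_inascreen: "proper_inascreen S D'"


section \<open>Almost Hermitian structures\<close>

text \<open>\<open>h\<close> may be degenerate.\<close>

definition almost_hermitian_structure ::
    "('m, 'e::euclidean_space) chart set \<Rightarrow> ('m \<Rightarrow> 'e \<Rightarrow> 'e \<Rightarrow> real) \<Rightarrow> ('m \<Rightarrow> 'e \<Rightarrow> 'e) \<Rightarrow> bool" where
  "almost_hermitian_structure A h \<phi> \<longleftrightarrow> symmetric_tensor_02 A h \<and> tensor_11 A \<phi> \<and>
     (\<forall>p X. \<phi> p (\<phi> p X) = - X) \<and>
     (\<forall>p X Y. h p (\<phi> p X) (\<phi> p Y) = h p X Y)"

end

theory Submission
  imports Defs
begin

text \<open>Since \<open>phib \<zeta> = 0\<close>, applying \<open>phib\<close> to \<open>phib X = \<phi> X + \<omega>(X) \<zeta>\<close> and comparing the components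
  tangent to \<open>M\<close> and along \<open>\<zeta>\<close> gives \<open>\<phi>\<^sup>2 = -I\<close> and \<open>\<omega>(\<phi> X) = \<eta>(X)\<close>; applying \<open>\<eta>\<close> instead gives
  \<open>\<eta>(\<phi> X) = -\<omega>(X)\<close>.  Expanding \<open>gb (phib X) (phib Y)\<close> then yields
  \<open>g(\<phi> X, \<phi> Y) = g(X, Y) - \<eta>(X) \<eta>(Y) + \<omega>(X) \<omega>(Y)\<close>, which is the compatibility with \<open>g + \<omega> \<otimes> \<omega>\<close>.
  The vector field \<open>\<zeta>\<close> is nowhere tangent to \<open>M\<close> because \<open>gb \<xi> \<zeta> = b \<noteq> 0\<close> while \<open>\<xi>\<close> is normal to \<open>M\<close>.
  Smoothness of \<open>\<phi>\<close> and \<open>\<omega>\<close> holds because the inverse of a smooth family of linear isomorphisms is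
  smooth.\<close>

section \<open>Calculus of \<open>C\<^sup>k\<close> maps\<close>

text \<open>\<open>frechet_derivative\<close> is a choice from the predicate
  \<open>has_derivative\<close>. The two predicates at x agree for every candidate D, so the choice
  returns the same map, whether or not a derivative exists.\<close>

lemma frechet_derivative_cong_on_open:
  assumes "open S" "x \<in> S" "\<And>y. y \<in> S \<Longrightarrow> f y = g y"
  shows "frechet_derivative f (at x) = frechet_derivative g (at x)"
proof -
  have "(f has_derivative D) (at x) \<longleftrightarrow> (g has_derivative D) (at x)" for D
    using assms has_derivative_transform_within_open[of f D x UNIV S g]
      has_derivative_transform_within_open[of g D x UNIV S f] by auto
  then show ?thesis
    by (simp add: frechet_derivative_def)
qed

lemma Ck_on_cong:
  assumes "open S" "Ck_on k S f" "\<And>x. x \<in> S \<Longrightarrow> f x = g x"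
  shows "Ck_on k S g"
  using assms(2,3)
proof (induction k arbitrary: f g)
  case 0
  then show ?case
    using continuous_on_cong by (metis Ck_on.simps(1))
next
  case (Suc k)
  have "g differentiable_on S"
    using Suc.prems by (metis Ck_on.simps(2) differentiable_on_def
        differentiable_transform_within zero_less_one)
  moreover have "Ck_on k S (\<lambda>x. frechet_derivative g (at x) v)" for v
  proof (rule Suc.IH)
    show "Ck_on k S (\<lambda>x. frechet_derivative f (at x) v)"
      using Suc.prems(1) by simp
    show "frechet_derivative f (at x) v = frechet_derivative g (at x) v" if "x \<in> S" for x
      using frechet_derivative_cong_on_open[OF assms(1) that Suc.prems(2)] by simp
  qed
  ultimately show ?case
    by simp
qed

lemma Ck_on_Suc_imp: "Ck_on (Suc k) S f \<Longrightarrow> Ck_on k S f"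
proof (induction k arbitrary: f)
  case 0
  then show ?case
    by (simp add: differentiable_imp_continuous_on)
next
  case (Suc k)
  then show ?case
    by (metis Ck_on.simps(2))
qed

lemma Ck_on_SucD:
  assumes "Ck_on (Suc k) S f" "open S" "x \<in> S"
  shows "f differentiable (at x)" "(f has_derivative frechet_derivative f (at x)) (at x)"
proof -
  show "f differentiable (at x)"
    using assms by (metis Ck_on.simps(2) differentiable_on_def at_within_open)
  then show "(f has_derivative frechet_derivative f (at x)) (at x)"
    by (simp add: frechet_derivative_works)
qed

text \<open>On an open set the derivative is unique, so an explicit formula \<open>f'\<close> may
  stand for \<open>frechet_derivative f\<close>. This is the introduction rule behind the inductions
  on k below.\<close>

lemma Ck_on_SucI:
  assumes "open S" "\<And>x. x \<in> S \<Longrightarrow> (f has_derivative f' x) (at x)"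
    and "\<And>v. Ck_on k S (\<lambda>x. f' x v)"
  shows "Ck_on (Suc k) S f"
proof -
  have "f differentiable_on S"
    using assms(1,2) by (meson differentiable_at_imp_differentiable_on differentiable_def)
  moreover have "Ck_on k S (\<lambda>x. frechet_derivative f (at x) v)" for v
    by (rule Ck_on_cong[OF assms(1) assms(3)[of v]]) (simp add: frechet_derivative_at[OF assms(2)])
  ultimately show ?thesis
    by simp
qed

text \<open>Differentiability at a point of an open piece does not refer to the piece, so membership
  in C^k is local. This is used to treat a chart domain as a union of smaller sets, one for each
  chart of a target manifold.\<close>

lemma Ck_on_Union:
  assumes "\<And>i. i \<in> I \<Longrightarrow> open (S i) \<and> Ck_on k (S i) f"
  shows "Ck_on k (\<Union>i\<in>I. S i) f"
  using assms
proof (induction k arbitrary: f)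
  case 0
  then show ?case
    by (simp add: continuous_on_open_UN)
next
  case (Suc k)
  have "f differentiable_on (\<Union>i\<in>I. S i)"
    using Suc.prems Ck_on_SucD(1) by (intro differentiable_at_imp_differentiable_on) blast
  moreover have "Ck_on k (\<Union>i\<in>I. S i) (\<lambda>x. frechet_derivative f (at x) v)" for v
    using Suc.prems by (intro Suc.IH) simp
  ultimately show ?case
    by simp
qed

section \<open>Constants, sums, products and composites of C^k maps\<close>

lemma Ck_on_const: "Ck_on k S (\<lambda>x. c)"
proof (induction k arbitrary: c)
  case (Suc k)
  then show ?case
    by (simp add: frechet_derivative_const differentiable_on_const)
qed simp

lemma Ck_on_add:
  assumes "open S" "Ck_on k S f" "Ck_on k S g"
  shows "Ck_on k S (\<lambda>x. f x + g x)"
  using assms(2,3)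
proof (induction k arbitrary: f g)
  case 0
  then show ?case
    by (simp add: continuous_on_add)
next
  case (Suc k)
  show ?case
  proof (rule Ck_on_SucI[OF assms(1)])
    fix x assume "x \<in> S"
    then show "((\<lambda>x. f x + g x) has_derivative
        (\<lambda>v. frechet_derivative f (at x) v + frechet_derivative g (at x) v)) (at x)"
      by (intro has_derivative_add Ck_on_SucD(2)[OF Suc.prems(1) assms(1)]
          Ck_on_SucD(2)[OF Suc.prems(2) assms(1)])
  next
    show "Ck_on k S (\<lambda>x. frechet_derivative f (at x) v + frechet_derivative g (at x) v)" for v
      using Suc.prems by (intro Suc.IH) simp_all
  qed
qed

lemma Ck_on_sum:
  assumes "open S" "\<And>i. i \<in> I \<Longrightarrow> Ck_on k S (f i)"
  shows "Ck_on k S (\<lambda>x. \<Sum>i\<in>I. f i x)"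
  using assms(2)
  by (induction I rule: infinite_finite_induct)
    (simp_all add: Ck_on_const Ck_on_add[OF assms(1)])

lemma Ck_on_linear:
  fixes h :: "'b::euclidean_space \<Rightarrow> 'c::euclidean_space"
  assumes "open S" "linear h" "Ck_on k S f"
  shows "Ck_on k S (\<lambda>x. h (f x))"
  using assms(3)
proof (induction k arbitrary: f)
  case 0
  then show ?case
    using linear_continuous_on_compose[OF _ assms(2)] by simp
next
  case (Suc k)
  show ?case
  proof (rule Ck_on_SucI[OF assms(1)])
    fix x assume "x \<in> S"
    then show "((\<lambda>x. h (f x)) has_derivative (\<lambda>v. h (frechet_derivative f (at x) v))) (at x)"
      using assms(2)
      by (intro bounded_linear.has_derivative[of h] Ck_on_SucD(2)[OF Suc.prems(1) assms(1)])
        (simp add: linear_conv_bounded_linear)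
  next
    show "Ck_on k S (\<lambda>x. h (frechet_derivative f (at x) v))" for v
      using Suc.prems by (intro Suc.IH) simp
  qed
qed

lemma Ck_on_scaleR:
  assumes "open S" "Ck_on k S f" "Ck_on k S g"
  shows "Ck_on k S (\<lambda>x. f x *\<^sub>R g x)"
  using assms(2,3)
proof (induction k arbitrary: f g)
  case 0
  then show ?case
    by (simp add: continuous_on_scaleR)
next
  case (Suc k)
  show ?case
  proof (rule Ck_on_SucI[OF assms(1)])
    fix x assume "x \<in> S"
    then show "((\<lambda>x. f x *\<^sub>R g x) has_derivative
        (\<lambda>v. f x *\<^sub>R frechet_derivative g (at x) v + frechet_derivative f (at x) v *\<^sub>R g x)) (at x)"
      by (intro has_derivative_scaleR Ck_on_SucD(2)[OF Suc.prems(1) assms(1)]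
          Ck_on_SucD(2)[OF Suc.prems(2) assms(1)])
  next
    show "Ck_on k S (\<lambda>x. f x *\<^sub>R frechet_derivative g (at x) v
        + frechet_derivative f (at x) v *\<^sub>R g x)" for v
      \<comment> \<open>The product rule mixes derivatives, which are C^k, with the factors
        themselves, which are C^(k+1) and have to be weakened to C^k before the induction hypothesis
        applies to both products.\<close>
      using Suc.prems Ck_on_Suc_imp[OF Suc.prems(1)] Ck_on_Suc_imp[OF Suc.prems(2)]
      by (intro Ck_on_add[OF assms(1)] Suc.IH) simp_all
  qed
qed

lemma linear_euclidean_expansion:
  fixes h :: "'a::euclidean_space \<Rightarrow> 'b::real_vector"
  assumes "linear h"
  shows "h v = (\<Sum>b\<in>Basis. (v \<bullet> b) *\<^sub>R h b)"
proof -
  have "h v = h (\<Sum>b\<in>Basis. (v \<bullet> b) *\<^sub>R b)"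
    by (simp add: euclidean_representation)
  also have "\<dots> = (\<Sum>b\<in>Basis. (v \<bullet> b) *\<^sub>R h b)"
    by (simp only: linear_sum[OF assms] linear_scale[OF assms])
  finally show ?thesis .
qed

text \<open>Expanding \<open>u x\<close> in the standard basis turns \<open>F x (u x)\<close> into a
  finite sum of scalar C^k coefficients times the C^k maps \<open>F x b\<close>. A family of linear
  maps is thus handled through its values on fixed vectors.\<close>

lemma Ck_on_apply:
  fixes F :: "'a::euclidean_space \<Rightarrow> 'b::euclidean_space \<Rightarrow> 'c::euclidean_space"
  assumes S: "open S" and F: "\<And>x. x \<in> S \<Longrightarrow> linear (F x)" "\<And>v. Ck_on k S (\<lambda>x. F x v)"
    and u: "Ck_on k S u"
  shows "Ck_on k S (\<lambda>x. F x (u x))"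
proof (rule Ck_on_cong[OF S])
  show "Ck_on k S (\<lambda>x. \<Sum>b\<in>Basis. (u x \<bullet> b) *\<^sub>R F x b)"
    by (intro Ck_on_sum Ck_on_scaleR S F(2) Ck_on_linear[OF _ _ u])
      (simp add: bounded_linear.linear bounded_linear_inner_left)
qed (rule linear_euclidean_expansion[OF F(1), symmetric])

text \<open>By the chain rule the derivative of the composite is the linear family
  \<open>frechet_derivative g (at (f x))\<close> applied to the derivative of f. The induction
  hypothesis, with g replaced by its directional derivatives, makes this family C^k, and
  \<open>Ck_on_apply\<close> combines the two.\<close>

lemma Ck_on_compose:
  fixes f :: "'a::euclidean_space \<Rightarrow> 'b::euclidean_space" and g :: "'b \<Rightarrow> 'c::euclidean_space"
  assumes S: "open S" and T: "open T" and fS: "f ` S \<subseteq> T"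
    and "Ck_on k T g" "Ck_on k S f"
  shows "Ck_on k S (\<lambda>x. g (f x))"
  using assms(4,5)
proof (induction k arbitrary: g)
  case 0
  then show ?case
    using continuous_on_compose2 fS by (metis Ck_on.simps(1))
next
  case (Suc k)
  note Dg = Ck_on_SucD(2)[OF Suc.prems(1) T] and Df = Ck_on_SucD(2)[OF Suc.prems(2) S]
  show ?case
  proof (rule Ck_on_SucI[OF S])
    show "((\<lambda>x. g (f x)) has_derivative
        (\<lambda>v. frechet_derivative g (at (f x)) (frechet_derivative f (at x) v))) (at x)"
      if "x \<in> S" for x
      using has_derivative_compose[OF Df Dg] that fS by blast
    show "Ck_on k S (\<lambda>x. frechet_derivative g (at (f x)) (frechet_derivative f (at x) v))" for v
    proof (rule Ck_on_apply[OF S, where F = "\<lambda>x. frechet_derivative g (at (f x))"])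
      show "linear (frechet_derivative g (at (f x)))" if "x \<in> S" for x
        using Dg[of "f x"] has_derivative_linear that fS by blast
      show "Ck_on k S (\<lambda>x. frechet_derivative g (at (f x)) w)" for w
        using Suc.prems(1) Ck_on_Suc_imp[OF Suc.prems(2)] by (intro Suc.IH) simp_all
      show "Ck_on k S (\<lambda>x. frechet_derivative f (at x) v)"
        using Suc.prems(2) by simp
    qed
  qed
qed

section \<open>Differentiating the inverse of a family of linear isomorphisms\<close>

lemma has_derivative_scaleR_zero:
  fixes f :: "'a::real_normed_vector \<Rightarrow> real" and g :: "'a \<Rightarrow> 'b::real_normed_vector"
  assumes f: "(f has_derivative f') (at x)" "f x = 0" and g: "isCont g x"
  shows "((\<lambda>y. f y *\<^sub>R g y) has_derivative (\<lambda>h. f' h *\<^sub>R g x)) (at x)"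
proof -
  obtain K where K: "0 < K" "\<And>h. norm (f' h) \<le> norm h * K"
    using bounded_linear.pos_bounded[OF has_derivative_bounded_linear[OF f(1)]] by blast
  \<comment> \<open>A Lipschitz bound at x: \<open>K\<close> bounds the linear part
    \<open>f'\<close>, and the added 1 absorbs the remainder.\<close>
  have Klip: "eventually (\<lambda>y. norm (f y) \<le> (K + 1) * norm (y - x)) (at x)"
  proof -
    obtain d where "d > 0" and d: "\<And>y. norm (y - x) < d \<Longrightarrow>
        norm (f y - f x - f' (y - x)) \<le> 1 * norm (y - x)"
      using f(1) unfolding has_derivative_at_alt by (meson zero_less_one)
    have "norm (f y) \<le> (K + 1) * norm (y - x)" if "norm (y - x) < d" for y
      using d[OF that] K(2)[of "y - x"] f(2) by (simp add: algebra_simps)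
    then show ?thesis
      using \<open>d > 0\<close> by (auto simp: eventually_at dist_norm)
  qed
  \<comment> \<open>As \<open>f x = 0\<close>, the factor \<open>f y\<close> is of order
    \<open>norm (y - x)\<close>, while \<open>g y - g x\<close> tends to 0 by continuity. The
    product is therefore of smaller order than \<open>norm (y - x)\<close>.\<close>
  have "((\<lambda>y. f y *\<^sub>R (g y - g x)) has_derivative (\<lambda>h. 0)) (at x)"
    unfolding has_derivative_iff_norm
  proof (intro conjI bounded_linear_zero, rule Lim_null_comparison)
    show "((\<lambda>y. (K + 1) * norm (g y - g x)) \<longlongrightarrow> 0) (at x)"
      using g by (auto simp: isCont_def LIM_zero tendsto_norm_zero intro: tendsto_mult_right_zero)
    show "eventually (\<lambda>y. norm (norm (f y *\<^sub>R (g y - g x) - f x *\<^sub>R (g x - g x) - 0) / norm (y - x))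
        \<le> (K + 1) * norm (g y - g x)) (at x)"
      using Klip eventually_at_ball[OF zero_less_one, of x]
    proof eventually_elim
      case (elim y)
      then have "norm (f y) * norm (g y - g x) \<le> ((K + 1) * norm (y - x)) * norm (g y - g x)"
        by (intro mult_right_mono) auto
      then show ?case
        using K(1) by (cases "y = x") (auto simp: divide_le_eq mult_ac)
    qed
  qed
  moreover have "((\<lambda>y. f y *\<^sub>R g x) has_derivative (\<lambda>h. f' h *\<^sub>R g x)) (at x)"
    by (rule has_derivative_scaleR_left[OF f(1)])
  ultimately have "((\<lambda>y. f y *\<^sub>R g x + f y *\<^sub>R (g y - g x)) has_derivative (\<lambda>h. f' h *\<^sub>R g x + 0)) (at x)"
    by (rule has_derivative_add[rotated])
  then show ?thesis
    by (simp add: algebra_simps)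
qed

text \<open>If \<open>L x\<close> is bounded below by c, then \<open>L y\<close> is bounded below by
  c/2 for y near x. Applied to \<open>M y w - M x w\<close>, whose image under \<open>L y\<close> is
  \<open>L x z - L y z\<close> with z = \<open>M x w\<close>, this bounds the difference by a
  quantity tending to 0.\<close>

lemma isCont_inverse_family:
  fixes L :: "'a::euclidean_space \<Rightarrow> 'b::euclidean_space \<Rightarrow> 'c::euclidean_space"
  assumes S: "open S" "x \<in> S" and L: "\<And>y. y \<in> S \<Longrightarrow> linear (L y)"
    and left_inv: "\<And>y v. y \<in> S \<Longrightarrow> M y (L y v) = v" and right_inv: "\<And>y w. y \<in> S \<Longrightarrow> L y (M y w) = w"
    and cont: "\<And>v. isCont (\<lambda>y. L y v) x"
  shows "isCont (\<lambda>y. M y w) x"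
proof -
  have "inj (L x)"
    using left_inv[OF S(2)] by (metis injI)
  then obtain c where c: "c > 0" "\<And>v. c * norm v \<le> norm (L x v)"
    using linear_inj_bounded_below_pos[OF L[OF S(2)]] by metis
  \<comment> \<open>\<open>e y\<close> dominates the operator norm of \<open>L y - L x\<close> and
    involves only finitely many fixed vectors, for which continuity is assumed.\<close>
  define e where "e = (\<lambda>y. \<Sum>b\<in>Basis. norm (L y b - L x b))"
  have e: "norm (L y v - L x v) \<le> norm v * e y" if "y \<in> S" for y v
  proof -
    have "L y v - L x v = (\<Sum>b\<in>Basis. (v \<bullet> b) *\<^sub>R (L y b - L x b))"
      using linear_euclidean_expansion[OF L[OF that], of v]
        linear_euclidean_expansion[OF L[OF S(2)], of v]
      by (simp add: sum_subtractf scaleR_right_diff_distrib)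
    also have "norm \<dots> \<le> (\<Sum>b\<in>Basis. norm v * norm (L y b - L x b))"
      by (intro sum_norm_le) (simp add: Basis_le_norm mult_right_mono)
    finally show ?thesis
      by (simp add: e_def sum_distrib_left)
  qed
  have "(e \<longlongrightarrow> 0) (at x)"
    unfolding e_def using cont by (intro tendsto_null_sum tendsto_norm_zero LIM_zero) (simp add: isCont_def)
  then have "eventually (\<lambda>y. e y < c / 2) (at x)"
    using c(1) by (metis half_gt_zero order_tendstoD(2))
  moreover have "eventually (\<lambda>y. y \<in> S) (at x)"
    using S by (rule eventually_at_in_open')
  ultimately have "eventually (\<lambda>y. norm (M y w - M x w) \<le>
      2 / c * norm (L y (M x w) - L x (M x w))) (at x)"
  proof eventually_elim
    case (elim y)
    have low: "c / 2 * norm v \<le> norm (L y v)" for v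
    proof -
      have "norm v * e y \<le> norm v * (c / 2)"
        using elim(1) by (intro mult_left_mono) auto
      then show ?thesis
        using c(2)[of v] e[OF elim(2), of v] norm_triangle_ineq2[of "L x v" "L y v"]
        by (simp add: norm_minus_commute mult.commute)
    qed
    have "L y (M y w - M x w) = L x (M x w) - L y (M x w)"
      using right_inv S(2) elim(2) by (simp add: linear_diff[OF L])
    then show ?case
      using low[of "M y w - M x w"] c(1) norm_minus_commute[of "L x (M x w)" "L y (M x w)"]
      by (simp add: pos_le_divide_eq mult.commute)
  qed
  moreover have "((\<lambda>y. 2 / c * norm (L y (M x w) - L x (M x w))) \<longlongrightarrow> 0) (at x)"
    using cont by (intro tendsto_mult_right_zero tendsto_norm_zero LIM_zero) (simp add: isCont_def)
  ultimately have "((\<lambda>y. M y w - M x w) \<longlongrightarrow> 0) (at x)"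
    by (rule Lim_null_comparison)
  then show ?thesis
    by (simp add: isCont_def LIM_zero_iff)
qed

text \<open>\<open>M y w - M x w = - M y (L y z - L x z)\<close> with \<open>z = M x w\<close>, where the second factor vanishes
  at \<open>x\<close>; so continuity of \<open>M\<close> suffices to differentiate.\<close>

lemma has_derivative_inverse_family:
  fixes L :: "'a::euclidean_space \<Rightarrow> 'b::euclidean_space \<Rightarrow> 'c::euclidean_space"
  assumes S: "open S" "x \<in> S" and L: "\<And>y. y \<in> S \<Longrightarrow> linear (L y)"
    and left_inv: "\<And>y v. y \<in> S \<Longrightarrow> M y (L y v) = v" and right_inv: "\<And>y w. y \<in> S \<Longrightarrow> L y (M y w) = w"
    and M: "\<And>y. y \<in> S \<Longrightarrow> linear (M y)"
    and D: "\<And>v. ((\<lambda>y. L y v) has_derivative L' v) (at x)"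
  shows "((\<lambda>y. M y w) has_derivative (\<lambda>h. - M x (L' (M x w) h))) (at x)"
proof -
  define z where "z = M x w"
  have "isCont (\<lambda>y. M y v) x" for v
    by (rule isCont_inverse_family[OF S L left_inv right_inv has_derivative_continuous[OF D]])
  moreover have "((\<lambda>y. (L y z - L x z) \<bullet> b) has_derivative (\<lambda>h. L' z h \<bullet> b)) (at x)" for b
    using D[of z] by (auto intro!: derivative_eq_intros)
  \<comment> \<open>In basis coordinates each summand is a scalar vanishing at x times a map that is
    continuous at x, which is the situation of \<open>has_derivative_scaleR_zero\<close>.\<close>
  ultimately have der: "((\<lambda>y. z - (\<Sum>b\<in>Basis. ((L y z - L x z) \<bullet> b) *\<^sub>R M y b)) has_derivative
      (\<lambda>h. 0 - (\<Sum>b\<in>Basis. (L' z h \<bullet> b) *\<^sub>R M x b))) (at x)"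
    by (intro has_derivative_diff has_derivative_const has_derivative_sum
        has_derivative_scaleR_zero) auto
  have eq: "z - (\<Sum>b\<in>Basis. ((L y z - L x z) \<bullet> b) *\<^sub>R M y b) = M y w" if "y \<in> S" for y
  proof -
    have "(\<Sum>b\<in>Basis. ((L y z - L x z) \<bullet> b) *\<^sub>R M y b) = M y (L y z - L x z)"
      by (rule linear_euclidean_expansion[OF M[OF that], symmetric])
    also have "\<dots> = z - M y w"
      using left_inv[OF that] right_inv[OF S(2)] by (simp add: linear_diff[OF M[OF that]] z_def)
    finally show ?thesis
      by simp
  qed
  have "0 - (\<Sum>b\<in>Basis. (L' z h \<bullet> b) *\<^sub>R M x b) = - M x (L' (M x w) h)" for h
    using linear_euclidean_expansion[OF M[OF S(2)], of "L' z h"] by (simp add: z_def)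
  then show ?thesis
    using has_derivative_transform_within_open[OF der S eq] by simp
qed

lemma linear_of_inverse:
  assumes f: "linear f" and gf: "\<And>v. g (f v) = v" and fg: "\<And>w. f (g w) = w"
  shows "linear g"
proof (rule linearI)
  fix v w and r :: real
  have "g (v + w) = g (f (g v + g w))"
    by (simp only: linear_add[OF f] fg)
  then show "g (v + w) = g v + g w"
    by (simp only: gf)
  have "g (r *\<^sub>R v) = g (f (r *\<^sub>R g v))"
    by (simp only: linear_scale[OF f] fg)
  then show "g (r *\<^sub>R v) = r *\<^sub>R g v"
    by (simp only: gf)
qed

text \<open>The derivative of the inverse is - M L' M, which contains M but no derivative of M. If M
  is C^k for every vector w and L' is C^k, then this derivative is C^k, so M is C^(k+1).\<close>

lemma Ck_on_inverse_family:
  fixes L :: "'a::euclidean_space \<Rightarrow> 'b::euclidean_space \<Rightarrow> 'c::euclidean_space"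
  assumes S: "open S" and L: "\<And>y. y \<in> S \<Longrightarrow> linear (L y)"
    and left_inv: "\<And>y v. y \<in> S \<Longrightarrow> M y (L y v) = v" and right_inv: "\<And>y w. y \<in> S \<Longrightarrow> L y (M y w) = w"
    and "\<And>v. Ck_on k S (\<lambda>y. L y v)"
  shows "Ck_on k S (\<lambda>y. M y w)"
proof -
  have M: "linear (M y)" if "y \<in> S" for y
    using linear_of_inverse[OF L[OF that]] left_inv[OF that] right_inv[OF that] by blast
  show ?thesis
    using assms(5)
  proof (induction k arbitrary: w)
    case 0
    have "isCont (\<lambda>y. M y w) x" if "x \<in> S" for x
      by (rule isCont_inverse_family[OF S that L left_inv right_inv])
        (use 0 that S in \<open>auto simp: continuous_on_eq_continuous_at\<close>)
    then show ?case
      using S by (simp add: continuous_on_eq_continuous_at)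
  next
    case (Suc k)
    define L' where "L' = (\<lambda>x v. frechet_derivative (\<lambda>y. L y v) (at x))"
    have L': "((\<lambda>y. L y v) has_derivative L' x v) (at x)" if "x \<in> S" for x v
      using Ck_on_SucD(2)[OF Suc.prems S that] by (simp add: L'_def)
    \<comment> \<open>Here linearity is in the vector on which \<open>L\<close> acts, not in the
      direction h. It follows by differentiating the linearity relations of \<open>L y\<close>,
      which hold for all y in S, and by uniqueness of derivatives.\<close>
    have lin: "linear (\<lambda>v. L' x v h)" if x: "x \<in> S" for x h
    proof (rule linearI)
      fix v w and r :: real
      have "((\<lambda>y. L y (v + w)) has_derivative (\<lambda>h. L' x v h + L' x w h)) (at x)"
        by (rule has_derivative_transform_within_open[OF has_derivative_add[OF L' L'] S x])
          (auto simp: x linear_add[OF L])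
      then show "L' x (v + w) h = L' x v h + L' x w h"
        by (rule has_derivative_unique[OF L'[OF x], THEN fun_cong])
      have "((\<lambda>y. L y (r *\<^sub>R v)) has_derivative (\<lambda>h. r *\<^sub>R L' x v h)) (at x)"
        by (rule has_derivative_transform_within_open[OF has_derivative_scaleR_right[OF L'] S x])
          (auto simp: x linear_scale[OF L])
      then show "L' x (r *\<^sub>R v) h = r *\<^sub>R L' x v h"
        by (rule has_derivative_unique[OF L'[OF x], THEN fun_cong])
    qed
    have IH: "Ck_on k S (\<lambda>x. M x w)" for w
      using Suc.IH Suc.prems Ck_on_Suc_imp by blast
    show ?case
    proof (rule Ck_on_SucI[OF S, where f' = "\<lambda>x h. - M x (L' x (M x w) h)"])
      show "((\<lambda>y. M y w) has_derivative (\<lambda>h. - M x (L' x (M x w) h))) (at x)" if "x \<in> S" for x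
        by (rule has_derivative_inverse_family[OF S that L left_inv right_inv M L'[OF that]])
      have "Ck_on k S (\<lambda>x. L' x (M x w) h)" for h
        using Suc.prems by (intro Ck_on_apply[OF S lin _ IH]) (auto simp: L'_def)
      then have "Ck_on k S (\<lambda>x. M x (L' x (M x w) h))" for h
        by (intro Ck_on_apply[OF S M IH])
      then show "Ck_on k S (\<lambda>x. - M x (L' x (M x w) h))" for h
        by (intro Ck_on_linear[OF S, of uminus]) (simp_all add: linear_iff)
    qed
  qed
qed

section \<open>Closure properties of smooth maps\<close>

lemma smooth_on_open: "smooth_on S f \<Longrightarrow> open S"
  by (simp add: smooth_on_def)

lemma smooth_on_has_derivative:
  assumes "smooth_on S f" "x \<in> S"
  shows "(f has_derivative frechet_derivative f (at x)) (at x)"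
  using assms Ck_on_SucD(2)[of 0 S f x] unfolding smooth_on_def by blast

lemma smooth_on_frechet_derivative:
  assumes "smooth_on S f"
  shows "smooth_on S (\<lambda>x. frechet_derivative f (at x) v)"
proof -
  have "Ck_on (Suc k) S f" for k
    using assms by (simp only: smooth_on_def)
  then show ?thesis
    using assms by (simp add: smooth_on_def)
qed

lemma smooth_on_cong:
  assumes "smooth_on S f" "\<And>x. x \<in> S \<Longrightarrow> f x = g x"
  shows "smooth_on S g"
  using assms Ck_on_cong[of S _ f g] unfolding smooth_on_def by blast

lemma smooth_on_Union:
  assumes "\<And>i. i \<in> I \<Longrightarrow> smooth_on (S i) f"
  shows "smooth_on (\<Union>i\<in>I. S i) f"
  using assms Ck_on_Union[of I S _ f] unfolding smooth_on_def by blast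

lemma smooth_on_add:
  assumes "smooth_on S f" "smooth_on S g"
  shows "smooth_on S (\<lambda>x. f x + g x)"
  using assms Ck_on_add[of S _ f g] unfolding smooth_on_def by blast

lemma smooth_on_linear:
  fixes h :: "'b::euclidean_space \<Rightarrow> 'c::euclidean_space"
  assumes "smooth_on S f" "linear h"
  shows "smooth_on S (\<lambda>x. h (f x))"
  using assms Ck_on_linear[of S h _ f] unfolding smooth_on_def by blast

lemma smooth_on_scaleR:
  assumes "smooth_on S f" "smooth_on S g"
  shows "smooth_on S (\<lambda>x. f x *\<^sub>R g x)"
  using assms Ck_on_scaleR[of S _ f g] unfolding smooth_on_def by blast

lemma smooth_on_mult:
  fixes f g :: "'a::euclidean_space \<Rightarrow> real"
  assumes "smooth_on S f" "smooth_on S g"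
  shows "smooth_on S (\<lambda>x. f x * g x)"
  using smooth_on_scaleR[OF assms] by simp

lemma smooth_on_compose:
  assumes "smooth_on T g" "smooth_on S f" "f ` S \<subseteq> T"
  shows "smooth_on S (\<lambda>x. g (f x))"
  using assms Ck_on_compose[of S T f _ g] unfolding smooth_on_def by blast

lemma smooth_on_apply:
  assumes "smooth_on S u" "\<And>x. x \<in> S \<Longrightarrow> linear (F x)" "\<And>v. smooth_on S (\<lambda>x. F x v)"
  shows "smooth_on S (\<lambda>x. F x (u x))"
  using assms Ck_on_apply[of S F _ u] unfolding smooth_on_def by blast

lemma smooth_on_inverse_family:
  assumes "open S" "\<And>y. y \<in> S \<Longrightarrow> linear (L y)"
    and "\<And>y v. y \<in> S \<Longrightarrow> M y (L y v) = v" "\<And>y w. y \<in> S \<Longrightarrow> L y (M y w) = w"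
    and "\<And>v. smooth_on S (\<lambda>y. L y v)"
  shows "smooth_on S (\<lambda>y. M y w)"
  using assms Ck_on_inverse_family[of S L M _ w] unfolding smooth_on_def by blast

text \<open>The composite needs to agree with h only near x: transition maps and local
  representatives compose as expected only on overlaps of chart domains.\<close>

lemma frechet_derivative_chain:
  assumes "(f has_derivative f') (at x)" "(g has_derivative g') (at (f x))"
    and "open S" "x \<in> S" "\<And>y. y \<in> S \<Longrightarrow> g (f y) = h y"
  shows "g' (f' v) = frechet_derivative h (at x) v"
proof -
  have "((\<lambda>y. g (f y)) has_derivative (\<lambda>v. g' (f' v))) (at x)"
    by (rule has_derivative_compose[OF assms(1,2)])
  then have "(h has_derivative (\<lambda>v. g' (f' v))) (at x)"
    by (rule has_derivative_transform_within_open[OF _ assms(3-5)])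
  then show ?thesis
    by (metis frechet_derivative_at)
qed


section \<open>Charts and tangent vectors\<close>

context smooth_manifold
begin

lemma chart_inv_snd [simp]:
  assumes "c \<in> A" "p \<in> fst c"
  shows "chart_inv c (snd c p) = p"
proof -
  have "inj_on (snd c) (fst c)"
    using charts[OF assms(1)] unfolding is_chart_def homeomorphism_def by (metis inj_on_inverseI)
  then show ?thesis
    using assms(2) by (simp add: chart_inv_def)
qed

lemma chart_at_in: "chart_at A p \<in> A \<and> p \<in> fst (chart_at A p)"
proof -
  have "\<exists>c. c \<in> A \<and> p \<in> fst c"
    using charts_cover by blast
  then show ?thesis
    unfolding chart_at_def by (rule someI_ex)
qed

lemma transition_snd:
  assumes "c \<in> A" "p \<in> fst c"
  shows "transition c d (snd c p) = snd d p"
  using assms by (simp add: transition_def)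

lemma transition_has_derivative:
  assumes "c \<in> A" "d \<in> A" "p \<in> fst c" "p \<in> fst d"
  shows "(transition c d has_derivative frechet_derivative (transition c d) (at (snd c p)))
    (at (snd c p))"
  using assms by (intro smooth_on_has_derivative[OF transition_smooth[of c d]]) auto

text \<open>The two transition maps compose to the identity on the overlap, so the chain rule makes
  their derivatives inverse to each other.\<close>

lemma transition_derivative_inverse:
  assumes "c \<in> A" "d \<in> A" "p \<in> fst c" "p \<in> fst d"
  shows "frechet_derivative (transition d c) (at (snd d p))
    (frechet_derivative (transition c d) (at (snd c p)) v) = v"
proof -
  have "frechet_derivative (transition d c) (at (snd d p))
    (frechet_derivative (transition c d) (at (snd c p)) v) = frechet_derivative (\<lambda>u. u) (at (snd c p)) v"
  proof (rule frechet_derivative_chain[OF transition_has_derivative[OF assms]])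
    show "(transition d c has_derivative frechet_derivative (transition d c) (at (snd d p)))
        (at (transition c d (snd c p)))"
      using transition_has_derivative[of d c p] assms by (simp add: transition_snd)
    show "open (snd c ` (fst c \<inter> fst d))"
      using transition_smooth[OF assms(1,2)] by (rule smooth_on_open)
    show "transition d c (transition c d u) = u" if "u \<in> snd c ` (fst c \<inter> fst d)" for u
      using that assms by (auto simp: transition_snd)
  qed (use assms in auto)
  then show ?thesis
    by simp
qed

context
  fixes c p
  assumes c: "c \<in> A" "p \<in> fst c"
begin

lemma linear_vector_of: "linear (vector_of A c p)"
  unfolding vector_of_def
  by (rule has_derivative_linear[OF transition_has_derivative]) (use c chart_at_in in auto)

lemma linear_coords_of: "linear (coords_of A c p)"
  unfolding coords_of_def
  by (rule has_derivative_linear[OF transition_has_derivative]) (use c chart_at_in in auto)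

lemma coords_of_vector_of: "coords_of A c p (vector_of A c p w) = w"
  unfolding coords_of_def vector_of_def
  by (rule transition_derivative_inverse) (use c chart_at_in in auto)

lemma vector_of_coords_of: "vector_of A c p (coords_of A c p v) = v"
  unfolding coords_of_def vector_of_def
  by (rule transition_derivative_inverse) (use c chart_at_in in auto)

end

end


section \<open>Smooth maps and their differentials in fixed charts\<close>

locale smooth_manifold_map =
  dom: smooth_manifold A + cod: smooth_manifold B
  for A :: "('m::{t2_space,second_countable_topology}, 'e::euclidean_space) chart set"
    and B :: "('n::{t2_space,second_countable_topology}, 'f::euclidean_space) chart set" +
  fixes F :: "'m \<Rightarrow> 'n"
  assumes smooth: "smooth_map A B F"
begin

definition local_rep :: "('m, 'e) chart \<Rightarrow> ('n, 'f) chart \<Rightarrow> 'e \<Rightarrow> 'f" where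
  "local_rep c d = snd d \<circ> F \<circ> chart_inv c"

definition local_domain :: "('m, 'e) chart \<Rightarrow> ('n, 'f) chart \<Rightarrow> 'e set" where
  "local_domain c d = snd c ` (fst c \<inter> F -` fst d)"

lemma local_rep_smooth: "c \<in> A \<Longrightarrow> d \<in> B \<Longrightarrow> smooth_on (local_domain c d) (local_rep c d)"
  using smooth unfolding smooth_map_def local_rep_def local_domain_def by blast

lemma local_rep_snd: "c \<in> A \<Longrightarrow> p \<in> fst c \<Longrightarrow> local_rep c d (snd c p) = snd d (F p)"
  by (simp add: local_rep_def)

lemma local_rep_has_derivative:
  assumes "c \<in> A" "d \<in> B" "p \<in> fst c" "F p \<in> fst d"
  shows "(local_rep c d has_derivative frechet_derivative (local_rep c d) (at (snd c p))) (at (snd c p))"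
  using assms by (intro smooth_on_has_derivative[OF local_rep_smooth[of c d]])
    (auto simp: local_domain_def)

text \<open>With d' the chart chosen at F p, both sides equal the derivative of
  \<open>local_rep c d'\<close> applied to w: one factors through the chart chosen at p, the other
  through d. This replaces the uncontrolled charts in \<open>differential\<close> by fixed ones, in
  which the derivative varies smoothly.\<close>

lemma differential_vector_of:
  assumes c: "c \<in> A" "p \<in> fst c" and d: "d \<in> B" "F p \<in> fst d"
  shows "differential A B F p (vector_of A c p w) =
    vector_of B d (F p) (frechet_derivative (local_rep c d) (at (snd c p)) w)"
proof -
  define c' where "c' = chart_at A p"
  define d' where "d' = chart_at B (F p)"
  have c': "c' \<in> A" "p \<in> fst c'"
    using dom.chart_at_in by (auto simp: c'_def)
  have d': "d' \<in> B" "F p \<in> fst d'"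
    using cod.chart_at_in by (auto simp: d'_def)
  have "frechet_derivative (local_rep c' d') (at (snd c' p))
      (frechet_derivative (transition c c') (at (snd c p)) w) =
      frechet_derivative (local_rep c d') (at (snd c p)) w"
  proof (rule frechet_derivative_chain[OF dom.transition_has_derivative[OF c(1) c'(1) c(2) c'(2)]])
    show "(local_rep c' d' has_derivative frechet_derivative (local_rep c' d') (at (snd c' p)))
        (at (transition c c' (snd c p)))"
      using local_rep_has_derivative[OF c'(1) d'(1) c'(2) d'(2)] c by (simp add: dom.transition_snd)
    show "open (snd c ` (fst c \<inter> fst c'))"
      using dom.transition_smooth[OF c(1) c'(1)] by (rule smooth_on_open)
    show "local_rep c' d' (transition c c' u) = local_rep c d' u" if "u \<in> snd c ` (fst c \<inter> fst c')" for u
      using that c c' by (auto simp: dom.transition_snd local_rep_snd)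
  qed (use c c' in auto)
  moreover have "frechet_derivative (transition d d') (at (snd d (F p)))
      (frechet_derivative (local_rep c d) (at (snd c p)) w) =
      frechet_derivative (local_rep c d') (at (snd c p)) w"
  proof (rule frechet_derivative_chain[OF local_rep_has_derivative[OF c(1) d(1) c(2) d(2)]])
    show "(transition d d' has_derivative frechet_derivative (transition d d') (at (snd d (F p))))
        (at (local_rep c d (snd c p)))"
      using cod.transition_has_derivative[OF d(1) d'(1) d(2) d'(2)] c by (simp add: local_rep_snd)
    show "open (local_domain c d)"
      using local_rep_smooth[OF c(1) d(1)] by (rule smooth_on_open)
    show "snd c p \<in> local_domain c d"
      using c d by (auto simp: local_domain_def)
    show "transition d d' (local_rep c d u) = local_rep c d' u" if "u \<in> local_domain c d" for u
      using that c d by (auto simp: local_domain_def cod.transition_snd local_rep_snd)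
  qed
  ultimately show ?thesis
    by (simp add: differential_def vector_of_def local_rep_def c'_def d'_def)
qed

lemma linear_differential: "linear (differential A B F p)"
proof -
  have "linear (frechet_derivative (local_rep (chart_at A p) (chart_at B (F p)))
      (at (snd (chart_at A p) p)))"
    by (rule has_derivative_linear[OF local_rep_has_derivative])
      (use dom.chart_at_in cod.chart_at_in in auto)
  then show ?thesis
    by (simp add: differential_def[abs_def] local_rep_def)
qed

text \<open>The preimages of the chart domains of the target cover the source, so smoothness may be
  checked with one target chart d fixed at a time.\<close>

lemma smooth_on_chart_domain:
  assumes "\<And>d. d \<in> B \<Longrightarrow> smooth_on (local_domain c d) f"
  shows "smooth_on (snd c ` fst c) f"
proof -
  have "snd c ` fst c = (\<Union>d\<in>B. local_domain c d)"
    using cod.charts_cover by (fastforce simp: local_domain_def)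
  then show ?thesis
    using smooth_on_Union[of B "local_domain c" f] assms by simp
qed

end


section \<open>Pointwise algebra of almost contact metric structures\<close>

context indefinite_almost_contact_metric_manifold
begin

lemma linear_phib: "linear (phib p)" and linear_eta: "linear (\<eta> p)" and bilinear_gb: "bilinear (gb p)"
  and gb_sym: "gb p v w = gb p w v"
  using phib_tensor eta_form metric_tensor
  unfolding tensor_11_def one_form_def symmetric_tensor_02_def by blast+

lemma phib_cubed: "phib p (phib p (phib p v)) = - phib p v + \<eta> p v *\<^sub>R phib p (\<zeta> p)"
  by (simp add: phib_squared[of p v] linear_diff[OF linear_phib] linear_scale[OF linear_phib])

lemma zeta_nonzero: "\<zeta> p \<noteq> 0"
  using eta_zeta[of p] linear_0[OF linear_eta, of p] by auto

text \<open>From \<open>phib_squared\<close>, phib^2 \<zeta> = 0. The same identity at phib \<zeta>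
  gives phib \<zeta> = r \<zeta> for a scalar r, and applying phib once more gives r phib \<zeta> =
  0. Either factor being zero yields the claim.\<close>

lemma phib_zeta: "phib p (\<zeta> p) = 0"
proof -
  have sq: "phib p (phib p (\<zeta> p)) = 0"
    by (simp add: phib_squared eta_zeta)
  then have eq: "phib p (\<zeta> p) = \<eta> p (phib p (\<zeta> p)) *\<^sub>R \<zeta> p"
    using phib_squared[of p "phib p (\<zeta> p)"] linear_0[OF linear_phib, of p] by simp
  then have "\<eta> p (phib p (\<zeta> p)) *\<^sub>R phib p (\<zeta> p) = 0"
    using sq linear_scale[OF linear_phib] by metis
  then show ?thesis
    using eq by (metis scaleR_eq_0_iff)
qed

text \<open>The cube of phib is computed in two ways, as phib^2 after phib and as phib after phib^2.
  The difference is \<eta>(phib v) \<zeta>, and \<zeta> is non-zero.\<close>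

lemma eta_phib: "\<eta> p (phib p v) = 0"
  using phib_squared[of p "phib p v"] phib_cubed[of p v] zeta_nonzero[of p] by (simp add: phib_zeta)

lemma gb_zeta: "gb p v (\<zeta> p) = \<eta> p v"
  using phib_metric[of p v "\<zeta> p"] bilinear_rzero[OF bilinear_gb] by (simp add: phib_zeta eta_zeta)

end


section \<open>Smoothness of the induced tensor fields\<close>

lemma (in smooth_manifold) symmetric_tensor_02_add_square:
  assumes h: "symmetric_tensor_02 A h" and \<omega>: "one_form A \<omega>"
  shows "symmetric_tensor_02 A (\<lambda>p v w. h p v w + \<omega> p v * \<omega> p w)"
  unfolding symmetric_tensor_02_def
proof (intro conjI allI ballI)
  have lin: "linear (\<omega> p)" and bil: "bilinear (h p)" for p
    using assms unfolding one_form_def symmetric_tensor_02_def by blast+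
  show "bilinear (\<lambda>v w. h p v w + \<omega> p v * \<omega> p w)" for p
    using bil[of p] unfolding bilinear_def
    by (auto simp: linear_iff algebra_simps linear_add[OF lin] linear_scale[OF lin])
  show "h p v w + \<omega> p v * \<omega> p w = h p w v + \<omega> p w * \<omega> p v" for p v w
    using h by (simp add: symmetric_tensor_02_def mult.commute)
  fix c v w assume "c \<in> A"
  then have "smooth_on (snd c ` fst c)
      (\<lambda>u. h (chart_inv c u) (vector_of A c (chart_inv c u) v) (vector_of A c (chart_inv c u) w))"
    and "smooth_on (snd c ` fst c) (\<lambda>u. \<omega> (chart_inv c u) (vector_of A c (chart_inv c u) v))" for v
    using assms unfolding one_form_def symmetric_tensor_02_def by blast+
  then show "smooth_on (snd c ` fst c)
      (\<lambda>u. h (chart_inv c u) (vector_of A c (chart_inv c u) v) (vector_of A c (chart_inv c u) w)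
        + \<omega> (chart_inv c u) (vector_of A c (chart_inv c u) v)
          * \<omega> (chart_inv c u) (vector_of A c (chart_inv c u) w))"
    by (intro smooth_on_add smooth_on_mult)
qed

section \<open>Pullback of symmetric tensor fields\<close>

context smooth_manifold_map
begin

lemma smooth_on_pullback:
  assumes "c \<in> A" "d \<in> B" "smooth_on (snd d ` fst d) (\<lambda>y. f (chart_inv d y))"
  shows "smooth_on (local_domain c d) (\<lambda>u. f (F (chart_inv c u)))"
proof (rule smooth_on_cong)
  show "smooth_on (local_domain c d) (\<lambda>u. f (chart_inv d (local_rep c d u)))"
    by (rule smooth_on_compose[OF assms(3) local_rep_smooth[OF assms(1,2)]])
      (use assms in \<open>auto simp: local_domain_def local_rep_snd\<close>)
qed (use assms in \<open>auto simp: local_domain_def local_rep_snd\<close>)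

lemma pullback_symmetric_tensor_02:
  assumes h: "symmetric_tensor_02 B h"
  shows "symmetric_tensor_02 A (\<lambda>p v w. h (F p) (differential A B F p v) (differential A B F p w))"
  unfolding symmetric_tensor_02_def
proof (intro conjI allI ballI)
  have bil: "bilinear (h q)" for q
    using h unfolding symmetric_tensor_02_def by blast
  show "bilinear (\<lambda>v w. h (F p) (differential A B F p v) (differential A B F p w))" for p
    using bil[of "F p"] linear_differential[of p] unfolding bilinear_def linear_iff by simp
  show "h (F p) (differential A B F p v) (differential A B F p w) =
      h (F p) (differential A B F p w) (differential A B F p v)" for p v w
    using h by (simp add: symmetric_tensor_02_def)
  fix c v w assume c: "c \<in> A"
  show "smooth_on (snd c ` fst c) (\<lambda>u. h (F (chart_inv c u))
      (differential A B F (chart_inv c u) (vector_of A c (chart_inv c u) v))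
      (differential A B F (chart_inv c u) (vector_of A c (chart_inv c u) w)))"
  proof (rule smooth_on_chart_domain)
    fix d assume d: "d \<in> B"
    let ?J = "\<lambda>v u. frechet_derivative (local_rep c d) (at u) v"
    \<comment> \<open>\<open>H u\<close> is the tensor at the image point in the coordinates of d.
      By \<open>differential_vector_of\<close> the pullback is \<open>H u\<close> with the Jacobian
      \<open>?J\<close> inserted in both slots, and the slots are filled one after the other by
      \<open>smooth_on_apply\<close>.\<close>
    define H where "H = (\<lambda>u v w. h (F (chart_inv c u)) (vector_of B d (F (chart_inv c u)) v)
        (vector_of B d (F (chart_inv c u)) w))"
    have J: "smooth_on (local_domain c d) (?J v)" for v
      by (rule smooth_on_frechet_derivative[OF local_rep_smooth[OF c d]])
    have H: "smooth_on (local_domain c d) (\<lambda>u. H u v w)" for v w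
      unfolding H_def
      by (rule smooth_on_pullback[OF c d, of "\<lambda>q. h q (vector_of B d q v) (vector_of B d q w)"])
        (use h d in \<open>simp add: symmetric_tensor_02_def\<close>)
    have lin: "linear (\<lambda>v. H u v w)" "linear (H u v)" if "u \<in> local_domain c d" for u v w
    proof -
      have "linear (vector_of B d (F (chart_inv c u)))"
        using that c d by (auto simp: local_domain_def intro: cod.linear_vector_of)
      then show "linear (\<lambda>v. H u v w)" "linear (H u v)"
        using bil[of "F (chart_inv c u)"] unfolding H_def bilinear_def linear_iff by simp_all
    qed
    have "smooth_on (local_domain c d) (\<lambda>u. H u (?J v u) w)" for w
      by (rule smooth_on_apply[OF J, where F = "\<lambda>u v. H u v w"]) (use lin H in auto)
    then have "smooth_on (local_domain c d) (\<lambda>u. H u (?J v u) (?J w u))"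
      by (intro smooth_on_apply[OF J, where F = "\<lambda>u. H u (?J v u)"]) (use lin in auto)
    then show "smooth_on (local_domain c d) (\<lambda>u. h (F (chart_inv c u))
        (differential A B F (chart_inv c u) (vector_of A c (chart_inv c u) v))
        (differential A B F (chart_inv c u) (vector_of A c (chart_inv c u) w)))"
      by (rule smooth_on_cong)
        (use c d in \<open>auto simp: local_domain_def H_def differential_vector_of\<close>)
  qed
qed

end

section \<open>Induced metric and the tensor fields \<phi>, \<omega> on the hypersurface\<close>

sublocale hypersurface \<subseteq> imm: smooth_manifold_map B A \<iota>
  by unfold_locales (rule immersion_smooth)

context hypersurface
begin

lemma induced_metric_tensor: "symmetric_tensor_02 B induced_metric"
  using imm.pullback_symmetric_tensor_02[OF metric_tensor] by (simp add: induced_metric_def[abs_def])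

context
  fixes \<phi> :: "'n \<Rightarrow> 'd \<Rightarrow> 'd" and \<omega> :: "'n \<Rightarrow> 'd \<Rightarrow> real"
  assumes transversal: "\<And>p. \<zeta> (\<iota> p) \<notin> range (d\<iota> p)"
    and decomposition: "\<And>p X. phib (\<iota> p) (d\<iota> p X) = d\<iota> p (\<phi> p X) + \<omega> p X *\<^sub>R \<zeta> (\<iota> p)"
begin

text \<open>Different coefficients of \<zeta> could be solved for \<zeta>, making it tangent. Once
  they agree, injectivity of the differential identifies the tangent parts. The pointwise identities
  for \<phi> and \<omega> are read off by comparing components in this way.\<close>

lemma transversal_unique:
  assumes "d\<iota> p X + s *\<^sub>R \<zeta> (\<iota> p) = d\<iota> p Y + t *\<^sub>R \<zeta> (\<iota> p)"
  shows "X = Y" "s = t"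
proof -
  have lin: "linear (d\<iota> p)"
    by (rule imm.linear_differential)
  show "s = t"
  proof (rule ccontr)
    assume "s \<noteq> t"
    have "(t - s) *\<^sub>R \<zeta> (\<iota> p) = d\<iota> p (X - Y)"
      using assms by (simp add: linear_diff[OF lin] algebra_simps)
    then have "\<zeta> (\<iota> p) = d\<iota> p ((1 / (t - s)) *\<^sub>R (X - Y))"
      using \<open>s \<noteq> t\<close> unfolding linear_scale[OF lin] by (metis divide_self_if eq_iff_diff_eq_0
          scaleR_one scaleR_scaleR times_divide_eq_left mult_1)
    then show False
      using transversal by blast
  qed
  then show "X = Y"
    using assms immersion_inj by (simp add: inj_eq)
qed

lemma linear_phi: "linear (\<phi> p)" and linear_omega: "linear (\<omega> p)"
proof -
  have lin: "linear (d\<iota> p)"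
    by (rule imm.linear_differential)
  have add: "d\<iota> p (\<phi> p (X + Y)) + \<omega> p (X + Y) *\<^sub>R \<zeta> (\<iota> p)
      = d\<iota> p (\<phi> p X + \<phi> p Y) + (\<omega> p X + \<omega> p Y) *\<^sub>R \<zeta> (\<iota> p)" for X Y
    using decomposition[of p "X + Y"] decomposition[of p X] decomposition[of p Y]
    by (simp add: linear_add[OF lin] linear_add[OF linear_phib] scaleR_add_left add_ac)
  have scale: "d\<iota> p (\<phi> p (r *\<^sub>R X)) + \<omega> p (r *\<^sub>R X) *\<^sub>R \<zeta> (\<iota> p)
      = d\<iota> p (r *\<^sub>R \<phi> p X) + (r * \<omega> p X) *\<^sub>R \<zeta> (\<iota> p)" for r X
    using decomposition[of p "r *\<^sub>R X"] decomposition[of p X]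
    by (simp add: linear_scale[OF lin] linear_scale[OF linear_phib] scaleR_add_right)
  show "linear (\<phi> p)" "linear (\<omega> p)"
    using transversal_unique[OF add] transversal_unique[OF scale] by (auto intro!: linearI)
qed

text \<open>In charts, \<open>(\<phi> X, \<omega> X)\<close> is the preimage of \<open>phib (d\<iota> X)\<close> under the isomorphism
  \<open>(v, t) \<mapsto> d\<iota> v + t \<zeta>\<close>, which depends smoothly on the point.\<close>

lemma phi_omega_smooth:
  assumes c: "c \<in> B"
  shows "smooth_on (snd c ` fst c)
    (\<lambda>u. (coords_of B c (chart_inv c u) (\<phi> (chart_inv c u) (vector_of B c (chart_inv c u) w)),
          \<omega> (chart_inv c u) (vector_of B c (chart_inv c u) w)))"
proof (rule imm.smooth_on_chart_domain)
  fix d assume d: "d \<in> A"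
  let ?D = "imm.local_domain c d"
  let ?q = "\<lambda>u. \<iota> (chart_inv c u)"
  \<comment> \<open>In the charts c and d: \<open>J\<close> is the Jacobian of the immersion,
    \<open>Z\<close> the components of \<zeta>, \<open>P\<close> the matrix of phib,
    \<open>L\<close> the map (v, t) to J v + t Z, and \<open>G\<close> its inverse.\<close>
  define J where "J = (\<lambda>u v. frechet_derivative (imm.local_rep c d) (at u) v)"
  define Z where "Z = (\<lambda>u. coords_of A d (?q u) (\<zeta> (?q u)))"
  define P where "P = (\<lambda>u v. coords_of A d (?q u) (phib (?q u) (vector_of A d (?q u) v)))"
  define L where "L = (\<lambda>u (v, t). J u v + t *\<^sub>R Z u)"
  define G where "G = (\<lambda>u. inv (L u))"
  have D: "chart_inv c u \<in> fst c" "?q u \<in> fst d" "u = snd c (chart_inv c u)" if "u \<in> ?D" for u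
    using that c by (auto simp: imm.local_domain_def)
  have openD: "open ?D"
    using imm.local_rep_smooth[OF c d] by (rule smooth_on_open)
  have J: "smooth_on ?D (\<lambda>u. J u v)" for v
    unfolding J_def by (rule smooth_on_frechet_derivative[OF imm.local_rep_smooth[OF c d]])
  have Z: "smooth_on ?D Z"
    unfolding Z_def
    by (rule imm.smooth_on_pullback[OF c d, of "\<lambda>q. coords_of A d q (\<zeta> q)"])
      (use zeta_field d in \<open>simp add: vector_field_on_def\<close>)
  have P: "smooth_on ?D (\<lambda>u. P u v)" for v
    unfolding P_def
    by (rule imm.smooth_on_pullback[OF c d, of "\<lambda>q. coords_of A d q (phib q (vector_of A d q v))"])
      (use phib_tensor d in \<open>simp add: tensor_11_def\<close>)
  have L_smooth: "smooth_on ?D (\<lambda>u. L u z)" for z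
  proof -
    have "smooth_on ?D (\<lambda>u. snd z *\<^sub>R Z u)"
      by (rule smooth_on_linear[OF Z]) (simp add: linear_iff scaleR_add_right)
    then show ?thesis
      using smooth_on_add[OF J] by (simp add: L_def case_prod_beta)
  qed
  have linJ: "linear (J u)" and dJ: "d\<iota> (chart_inv c u) (vector_of B c (chart_inv c u) v)
      = vector_of A d (?q u) (J u v)" if "u \<in> ?D" for u v
  proof -
    show "linear (J u)"
      using has_derivative_linear[OF smooth_on_has_derivative[OF imm.local_rep_smooth[OF c d] that]]
      by (simp add: J_def)
    show "d\<iota> (chart_inv c u) (vector_of B c (chart_inv c u) v) = vector_of A d (?q u) (J u v)"
      using imm.differential_vector_of[OF c D(1)[OF that] d D(2)[OF that]] D(3)[OF that]
      by (simp add: J_def)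
  qed
  \<comment> \<open>Back in the ambient tangent space, \<open>L\<close> becomes the map adding a
    tangent vector and a multiple of \<zeta>, so its injectivity reduces to
    \<open>transversal_unique\<close>.\<close>
  have L_vec: "vector_of A d (?q u) (L u (v, t))
      = d\<iota> (chart_inv c u) (vector_of B c (chart_inv c u) v) + t *\<^sub>R \<zeta> (?q u)" if "u \<in> ?D" for u v t
    using D[OF that] linear_vector_of[OF d D(2)[OF that]]
    by (simp add: L_def Z_def linear_add linear_scale vector_of_coords_of[OF d] dJ[OF that])
  have linL: "linear (L u)" if "u \<in> ?D" for u
    using linJ[OF that] by (auto simp: linear_iff L_def algebra_simps)
  have bijL: "bij (L u)" if u: "u \<in> ?D" for u
  proof -
    have "inj (L u)"
    proof (rule injI)
      fix y z assume "L u y = L u z"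
      then have eq: "d\<iota> (chart_inv c u) (vector_of B c (chart_inv c u) (fst y)) + snd y *\<^sub>R \<zeta> (?q u)
          = d\<iota> (chart_inv c u) (vector_of B c (chart_inv c u) (fst z)) + snd z *\<^sub>R \<zeta> (?q u)"
        using L_vec[OF u] by (metis prod.collapse)
      have "fst y = fst z"
        using transversal_unique(1)[OF eq] M.coords_of_vector_of[OF c D(1)[OF u]] by metis
      then show "y = z"
        using transversal_unique(2)[OF eq] by (simp add: prod_eq_iff)
    qed
    \<comment> \<open>Codimension 1 enters here: with equal dimensions, injectivity already gives
      bijectivity.\<close>
    moreover have "DIM('d \<times> real) = DIM('e)"
      by (simp add: codimension_1)
    ultimately show ?thesis
      using linear_injective_imp_surjective[OF linL[OF u]] by (simp add: bij_def)
  qed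
  have GL: "G u (L u z) = z" and LG: "L u (G u w) = w" if "u \<in> ?D" for u z w
    using bijL[OF that] by (simp_all add: G_def inv_f_f bij_is_inj surj_f_inv_f bij_is_surj)
  have linG: "linear (G u)" if "u \<in> ?D" for u
    using linear_of_inverse[OF linL[OF that]] GL[OF that] LG[OF that] by blast
  have linP: "linear (P u)" if "u \<in> ?D" for u
    using linear_vector_of[OF d D(2)[OF that]] linear_coords_of[OF d D(2)[OF that]] linear_phib
    by (simp add: P_def linear_iff)
  have "smooth_on ?D (\<lambda>u. P u (J u w))"
    by (rule smooth_on_apply[OF J linP P])
  then have "smooth_on ?D (\<lambda>u. G u (P u (J u w)))"
    by (rule smooth_on_apply[OF _ linG]) (auto intro: smooth_on_inverse_family[OF openD linL GL LG L_smooth])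
  then show "smooth_on ?D
    (\<lambda>u. (coords_of B c (chart_inv c u) (\<phi> (chart_inv c u) (vector_of B c (chart_inv c u) w)),
          \<omega> (chart_inv c u) (vector_of B c (chart_inv c u) w)))"
  proof (rule smooth_on_cong)
    fix u assume u: "u \<in> ?D"
    let ?p = "chart_inv c u"
    let ?X = "vector_of B c ?p w"
    have "vector_of A d (?q u) (L u (coords_of B c ?p (\<phi> ?p ?X), \<omega> ?p ?X)) = phib (?q u) (d\<iota> ?p ?X)"
      by (simp add: L_vec[OF u] M.vector_of_coords_of[OF c D(1)[OF u]] decomposition)
    also have "\<dots> = vector_of A d (?q u) (P u (J u w))"
      by (simp add: P_def dJ[OF u] vector_of_coords_of[OF d D(2)[OF u]])
    finally have "L u (coords_of B c ?p (\<phi> ?p ?X), \<omega> ?p ?X) = P u (J u w)"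
      using coords_of_vector_of[OF d D(2)[OF u]] by metis
    then show "G u (P u (J u w)) = (coords_of B c ?p (\<phi> ?p ?X), \<omega> ?p ?X)"
      using GL[OF u] by metis
  qed
qed

lemma phi_tensor: "tensor_11 B \<phi>" and omega_form: "one_form B \<omega>"
proof -
  have "linear (fst :: 'd \<times> real \<Rightarrow> 'd)" "linear (snd :: 'd \<times> real \<Rightarrow> real)"
    by (simp_all add: linear_fst linear_snd)
  note smooth = smooth_on_linear[OF phi_omega_smooth this(1)] smooth_on_linear[OF phi_omega_smooth this(2)]
  show "tensor_11 B \<phi>" "one_form B \<omega>"
    using smooth linear_phi linear_omega by (simp_all add: tensor_11_def one_form_def)
qed

lemma phi_squared: "\<phi> p (\<phi> p X) = - X" and omega_phi: "\<omega> p (\<phi> p X) = \<eta> (\<iota> p) (d\<iota> p X)"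
proof -
  have lin: "linear (d\<iota> p)"
    by (rule imm.linear_differential)
  have "phib (\<iota> p) (phib (\<iota> p) (d\<iota> p X)) = phib (\<iota> p) (d\<iota> p (\<phi> p X))"
    by (simp add: decomposition[of p X] linear_add[OF linear_phib] linear_scale[OF linear_phib] phib_zeta)
  then have eq: "d\<iota> p (\<phi> p (\<phi> p X)) + \<omega> p (\<phi> p X) *\<^sub>R \<zeta> (\<iota> p)
      = d\<iota> p (- X) + \<eta> (\<iota> p) (d\<iota> p X) *\<^sub>R \<zeta> (\<iota> p)"
    using decomposition[of p "\<phi> p X"] by (simp only: phib_squared linear_neg[OF lin])
  show "\<phi> p (\<phi> p X) = - X" "\<omega> p (\<phi> p X) = \<eta> (\<iota> p) (d\<iota> p X)"
    by (rule transversal_unique[OF eq])+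
qed

lemma eta_phi: "\<eta> (\<iota> p) (d\<iota> p (\<phi> p X)) = - \<omega> p X"
  using eta_phib[of "\<iota> p" "d\<iota> p X"]
  by (simp add: decomposition linear_add[OF linear_eta] linear_scale[OF linear_eta] eta_zeta)

lemma induced_metric_phi:
  "induced_metric p (\<phi> p X) (\<phi> p Y) = induced_metric p X Y
    - \<eta> (\<iota> p) (d\<iota> p X) * \<eta> (\<iota> p) (d\<iota> p Y) + \<omega> p X * \<omega> p Y"
proof -
  let ?g = "gb (\<iota> p)"
  have "?g (phib (\<iota> p) (d\<iota> p X)) (phib (\<iota> p) (d\<iota> p Y)) =
      induced_metric p (\<phi> p X) (\<phi> p Y) + \<omega> p Y * \<eta> (\<iota> p) (d\<iota> p (\<phi> p X))
      + \<omega> p X * \<eta> (\<iota> p) (d\<iota> p (\<phi> p Y)) + \<omega> p X * \<omega> p Y"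
    by (simp add: decomposition induced_metric_def bilinear_ladd[OF bilinear_gb]
        bilinear_radd[OF bilinear_gb] bilinear_lmul[OF bilinear_gb] bilinear_rmul[OF bilinear_gb]
        gb_zeta gb_sym[of _ "\<zeta> _"] eta_zeta
        linear_add[OF linear_eta] linear_scale[OF linear_eta] algebra_simps)
  also have "\<dots> = induced_metric p (\<phi> p X) (\<phi> p Y) - \<omega> p X * \<omega> p Y"
    by (simp add: eta_phi)
  finally show ?thesis
    by (simp add: phib_metric induced_metric_def)
qed

text \<open>Under \<phi> the metric g loses \<eta>(X) \<eta>(Y) and gains \<omega>(X) \<omega>(Y).
  Since \<omega>(\<phi> X) = \<eta>(X), the added square restores the first term, and the second is
  its own value at X and Y.\<close>

lemma almost_hermitian:
  "almost_hermitian_structure B (\<lambda>p X Y. induced_metric p X Y + \<omega> p X * \<omega> p Y) \<phi>"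
  unfolding almost_hermitian_structure_def
  using M.symmetric_tensor_02_add_square[OF induced_metric_tensor omega_form] phi_tensor
  by (simp add: phi_squared induced_metric_phi omega_phi)

end

end

section \<open>Transversality of \<zeta> and the conclusion\<close>

lemma (in proper_inascreen_lightlike_hypersurface) zeta_transversal:
  "\<zeta> (\<iota> p) \<notin> range (d\<iota> p)"
proof
  assume "\<zeta> (\<iota> p) \<in> range (d\<iota> p)"
  then obtain Y where Y: "\<zeta> (\<iota> p) = d\<iota> p Y"
    by blast
  have "dim (rad p) = 1"
    using lightlike by (simp add: lightlike_def distribution_def)
  then obtain \<xi> where \<xi>: "\<xi> \<in> rad p - {0}"
    by (metis Diff_iff dim_eq_0 singletonI subsetI zero_neq_one)
  \<comment> \<open>\<open>inascreen\<close> supplies a decomposition for this \<xi>; the universal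
    clause of \<open>proper_inascreen\<close> then applies to it and gives b \<noteq> 0.\<close>
  then obtain N W a b W' where z: "zeta_decomposition S D' p \<xi> N W a b W'"
    using proper_inascreen unfolding proper_inascreen_def inascreen_def by blast
  then have "b \<noteq> 0"
    using proper_inascreen \<xi> unfolding proper_inascreen_def by blast
  have null: "gb (\<iota> p) (d\<iota> p \<xi>) (d\<iota> p X) = 0" for X
    using \<xi> by (simp add: rad_def normal_space_def)
  \<comment> \<open>The tangent components W and a \<xi> pair to zero with \<xi>, and N is
    normalized to pair to 1.\<close>
  have "gb (\<iota> p) (d\<iota> p \<xi>) (\<zeta> (\<iota> p)) = b"
    using z by (simp add: zeta_decomposition_def is_transversal_def null
        bilinear_radd[OF bilinear_gb] bilinear_rmul[OF bilinear_gb])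
  then show False
    using \<open>b \<noteq> 0\<close> null[of Y] by (simp add: Y)
qed

theorem theorem4p5:
  fixes A :: "('m::{t2_space,second_countable_topology}, 'e::euclidean_space) chart set"
    and phib :: "'m \<Rightarrow> 'e \<Rightarrow> 'e"
    and \<zeta> :: "'m \<Rightarrow> 'e"
    and \<eta> :: "'m \<Rightarrow> 'e \<Rightarrow> real"
    and gb :: "'m \<Rightarrow> 'e \<Rightarrow> 'e \<Rightarrow> real"
    and B :: "('n::{t2_space,second_countable_topology}, 'd::euclidean_space) chart set"
    and \<iota> :: "'n \<Rightarrow> 'm"
    and S D' :: "'n \<Rightarrow> 'd set"
    and \<phi> :: "'n \<Rightarrow> 'd \<Rightarrow> 'd"
    and \<omega> :: "'n \<Rightarrow> 'd \<Rightarrow> real"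
    and gt :: "'n \<Rightarrow> 'd \<Rightarrow> 'd \<Rightarrow> real"
  assumes "proper_inascreen_lightlike_hypersurface A phib \<zeta> \<eta> gb B \<iota> S D'"
    and "\<And>p X. phib (\<iota> p) (differential B A \<iota> p X)
                 = differential B A \<iota> p (\<phi> p X) + \<omega> p X *\<^sub>R \<zeta> (\<iota> p)"
    and "\<And>p X Y. gt p X Y = hypersurface.induced_metric A gb B \<iota> p X Y + \<omega> p X * \<omega> p Y"
  shows "almost_hermitian_structure B gt \<phi>"
proof -
  interpret proper_inascreen_lightlike_hypersurface A phib \<zeta> \<eta> gb B \<iota> S D'
    by (rule assms(1))
  have "gt = (\<lambda>p X Y. induced_metric p X Y + \<omega> p X * \<omega> p Y)"
    using assms(3) by (intro ext)
  then show ?thesis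
    using almost_hermitian[OF zeta_transversal assms(2)] by simp
qed

end
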